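(* Let $(G,+)$ be an abelian group, let $(E,\langle\cdot,\cdot\rangle)$ be an inner product space over $\mathbb{K}$, where $\mathbb{K}=\mathbb{R}$ or $\mathbb{K}=\mathbb{C}$, with associated norm $\|\cdot\|$, and let $f:G\rightarrow E$ be a mapping such that $$\|2f(x)+f(y)+f(-y)-f(x-y)\|\leq \|f(x+y)\|$$ for all $x,y\in G$. Then $f$ is a solution of the Drygas functional equation $$f(x+y)+f(x-y)=2f(x)+f(y)+f(-y)\quad\text{for all } x,y\in G.$$
   Context: The norm on $E$ is the one derived from the inner product, $\|v\|=\sqrt{\langle v,v\rangle}$. $E$ is not assumed to be complete, and $G$ is not assumed to be 2-divisible. *)

theory Defs
  imports "HOL-Analysis.Inner_Product"
begin

text \<open>
  Real inner product spaces are the type class \<^class>\<open>real_inner\<close>. The library has no complex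
  counterpart, so these are introduced here on top of \<^locale>\<open>vector_space\<close>. The inner product is
  linear in its first argument and conjugate-linear in the second; since swapping the two
  arguments of the inner product leaves the norm unchanged, the opposite convention yields the
  same norms. By \<open>conj_sym\<close> the value \<open>ip v v\<close> is real, so positivity is a condition on
  its real part.
\<close>

locale complex_inner_product_space = vector_space scale
  for scale :: "complex \<Rightarrow> 'e::ab_group_add \<Rightarrow> 'e" +
  fixes ip :: "'e \<Rightarrow> 'e \<Rightarrow> complex"
  assumes add_left: "ip (u + v) w = ip u w + ip v w"
    and scale_left: "ip (scale c u) w = c * ip u w"
    and conj_sym: "ip v u = cnj (ip u v)"
    and nonneg: "0 \<le> Re (ip v v)"
    and definite: "ip v v = 0 \<Longrightarrow> v = 0"

definition ip_norm :: "('e \<Rightarrow> 'e \<Rightarrow> complex) \<Rightarrow> 'e \<Rightarrow> real" where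
  "ip_norm ip v = sqrt (Re (ip v v))"

end

theory Submission
  imports Defs
begin

text \<open>
  Write \<open>\<Delta> x y = f (x + y) + f (x - y) - 2 f x - f y - f (- y)\<close> for the Drygas defect. The
  hypothesis compares the norms of \<open>f (x + y) - \<Delta> x y\<close> and \<open>f (x + y)\<close>, so squaring it gives
  \<open>\<parallel>\<Delta> x y\<parallel>\<^sup>2 \<le> 2 \<langle>f (x + y), \<Delta> x y\<rangle>\<close> (lemma \<open>norm_defect_le\<close>). This inequality is used in two ways.

  \<^item> As \<open>\<Delta> x y\<close> does not change when \<open>y\<close> is replaced by \<open>- y\<close>, averaging the two instances gives
    \<open>\<langle>2 f x + f y + f (- y), \<Delta> x y\<rangle> \<ge> 0\<close>.
  \<^item> The case \<open>y = - x\<close> of the hypothesis is \<open>f (2 x) = 3 f x + f (- x)\<close>, and this turns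
    \<open>\<Delta> (x + y) (x - y)\<close> into \<open>- (\<Delta> x y + \<Delta> y x)\<close>. The inequality at \<open>(x + y, x - y)\<close> therefore bounds
    \<open>\<parallel>\<Delta> x y + \<Delta> y x\<parallel>\<^sup>2\<close> above by \<open>- 2 \<langle>3 f x + f (- x), \<Delta> x y + \<Delta> y x\<rangle>\<close>: the opposite sign.

  For even \<open>f\<close> these two facts already force \<open>\<Delta> = 0\<close>. In general \<open>f\<close> and \<open>\<Delta>\<close> are split
  into even and odd parts. The first fact then becomes \<open>N x y + K x y \<ge> 0\<close> with an even term \<open>N\<close> and
  an odd term \<open>K\<close>, and the second one bounds a sum of squares by a negative combination of such terms in
  which \<open>N\<close> has more weight than the first fact can absorb. What is missing is \<open>N \<ge> 0\<close>.
  Under \<open>(x, y) \<mapsto> (2 x, 2 y)\<close> the even parts are multiplied by \<open>4\<close> and the odd parts by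
  \<open>2\<close>, so that \<open>N\<close> is multiplied by \<open>16\<close> and \<open>K\<close> only by \<open>4\<close>; iterating the doubling gives
  \<open>N \<ge> 0\<close>. The group elements are only ever doubled, never halved, and the passage to the limit
  concerns real numbers, not vectors.

  The target is treated as an abelian group with a real-valued, symmetric, biadditive, positive
  definite form \<open>B\<close>, which covers a real inner product and the real part of a complex one at once.
\<close>

section \<open>Positive definite biadditive forms\<close>

locale positive_definite_form =
  fixes B :: "'e::ab_group_add \<Rightarrow> 'e \<Rightarrow> real"
  assumes add_left: "B (u + v) w = B u w + B v w"
    and sym: "B u v = B v u"
    and nonneg: "0 \<le> B v v"
    and definite: "B v v = 0 \<Longrightarrow> v = 0"
begin

lemma add_right: "B w (u + v) = B w u + B w v"
  by (metis add_left sym)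

lemma zero_left: "B 0 w = 0"
  using add_left[of 0 0 w] by simp

lemma minus_left: "B (- u) w = - B u w"
  using add_left[of "- u" u w] by (simp add: zero_left)

lemma minus_right: "B w (- u) = - B w u"
  by (metis minus_left sym)

lemma diff_left: "B (u - v) w = B u w - B v w"
  using add_left[of u "- v" w] by (simp add: minus_left)

lemma diff_right: "B w (u - v) = B w u - B w v"
  by (metis diff_left sym)

lemmas bilinear = add_left add_right minus_left minus_right diff_left diff_right

end

section \<open>The defect of the Drygas equation\<close>

locale drygas_inequality = positive_definite_form B
  for B :: "'e::ab_group_add \<Rightarrow> 'e \<Rightarrow> real" +
  fixes f :: "'g::ab_group_add \<Rightarrow> 'e"
  assumes ineq: "B (f x + f x + f y + f (- y) - f (x - y)) (f x + f x + f y + f (- y) - f (x - y))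
    \<le> B (f (x + y)) (f (x + y))"
begin

definition defect :: "'g \<Rightarrow> 'g \<Rightarrow> 'e" where
  "defect x y = f (x + y) + f (x - y) - f x - f x - f y - f (- y)"

text \<open>
  The even and odd parts below are twice the usual ones, because the target need not admit halving.
\<close>

definition even_part :: "'g \<Rightarrow> 'e" where
  "even_part x = f x + f (- x)"

definition odd_part :: "'g \<Rightarrow> 'e" where
  "odd_part x = f x - f (- x)"

definition even_defect :: "'g \<Rightarrow> 'g \<Rightarrow> 'e" where
  "even_defect x y = defect x y + defect (- x) y"

definition odd_defect :: "'g \<Rightarrow> 'g \<Rightarrow> 'e" where
  "odd_defect x y = defect x y - defect (- x) y"

lemma norm_defect_le: "B (defect x y) (defect x y) \<le> 2 * B (f (x + y)) (defect x y)"
proof -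
  have "f x + f x + f y + f (- y) - f (x - y) = f (x + y) - defect x y"
    by (simp add: defect_def algebra_simps)
  with ineq[of x y] show ?thesis
    using sym[of "f (x + y)" "defect x y"] by (simp add: diff_left diff_right)
qed

lemma defect_minus_right: "defect x (- y) = defect x y"
  by (simp add: defect_def algebra_simps)

lemma f_zero: "f 0 = 0"
proof -
  have "B (f 0 + f 0 + f 0) (f 0 + f 0 + f 0) \<le> B (f 0) (f 0)"
    using ineq[of 0 0] by simp
  then have "B (f 0) (f 0) = 0"
    using nonneg[of "f 0"] by (simp add: bilinear)
  then show ?thesis
    by (rule definite)
qed

lemma f_double: "f (x + x) = f x + f x + f x + f (- x)"
proof -
  let ?v = "f x + f x + f (- x) + f x - f (x + x)"
  have "B ?v ?v \<le> B 0 0"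
    using ineq[of x "- x"] by (simp add: f_zero)
  then have "?v = 0"
    using nonneg[of ?v] by (intro definite) (simp add: zero_left)
  then show ?thesis
    by (simp add: algebra_simps)
qed

lemma f_minus_double: "f (- x - x) = f (- x) + f (- x) + f (- x) + f x"
  using f_double[of "- x"] by simp

text \<open>
  The sign reversal on which the proof rests: the sum and the difference of \<open>x + y\<close> and \<open>x - y\<close> are
  doubles, so \<open>f\<close> at these points reduces to values at \<open>\<plusminus> x\<close> and \<open>\<plusminus> y\<close>.
\<close>

lemma defect_sum_difference: "defect (x + y) (x - y) = - (defect x y + defect y x)"
proof -
  have "defect (x + y) (x - y) = f (x + x) + f (y + y) - f (x + y) - f (x + y) - f (x - y) - f (y - x)"
    by (simp add: defect_def algebra_simps)
  then show ?thesis
    unfolding f_double by (simp add: defect_def algebra_simps)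
qed

lemma norm_symmetrized_defect_le:
  "B (defect x y + defect y x) (defect x y + defect y x)
     \<le> - 2 * B (even_part x + even_part x + odd_part x) (defect x y + defect y x)"
proof -
  have "f (x + y + (x - y)) = even_part x + even_part x + odd_part x"
    using f_double[of x] by (simp add: even_part_def odd_part_def algebra_simps)
  then show ?thesis
    using norm_defect_le[of "x + y" "x - y"]
    unfolding defect_sum_difference by (simp only: minus_left minus_right)
qed

text \<open>
  The square of the defect is bounded through \<open>f (x + y)\<close> and, replacing \<open>y\<close> by \<open>- y\<close>, through
  \<open>f (x - y)\<close>. These two values add up to \<open>\<Delta> x y + 2 f x + f y + f (- y)\<close>, so in the mean of the two
  bounds the square cancels.
\<close>

lemma defect_positive: "0 \<le> B (f x + f x + even_part y) (defect x y)"
proof -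
  have "B (defect x y) (defect x y) \<le> B (f (x + y) + f (x - y)) (defect x y)"
    using norm_defect_le[of x y] norm_defect_le[of x "- y"]
    by (simp add: defect_minus_right add_left)
  also have "f (x + y) + f (x - y) = defect x y + (f x + f x + even_part y)"
    by (simp add: defect_def even_part_def algebra_simps)
  finally show ?thesis
    by (simp add: add_left)
qed

section \<open>Separating the even from the odd part by doubling\<close>

definition even_term :: "'g \<Rightarrow> 'g \<Rightarrow> real" where
  "even_term x y = B (even_part x + even_part y) (even_defect x y)"

definition odd_term :: "'g \<Rightarrow> 'g \<Rightarrow> real" where
  "odd_term x y = B (odd_part x) (odd_defect x y)"

lemma even_part_minus: "even_part (- x) = even_part x"
  by (simp add: even_part_def algebra_simps)

lemma odd_part_minus: "odd_part (- x) = - odd_part x"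
  by (simp add: odd_part_def algebra_simps)

lemma even_defect_eq:
  "even_defect x y = even_part (x + y) + even_part (x - y)
     - even_part x - even_part x - even_part y - even_part y"
  by (simp add: even_defect_def defect_def even_part_def algebra_simps)

lemma odd_defect_eq:
  "odd_defect x y = odd_part (x + y) + odd_part (x - y) - odd_part x - odd_part x"
  by (simp add: odd_defect_def defect_def odd_part_def algebra_simps)

lemma even_defect_commute: "even_defect x y = even_defect y x"
  using even_part_minus[of "x - y"] by (simp add: even_defect_eq algebra_simps)

lemma even_term_commute: "even_term x y = even_term y x"
  by (simp add: even_term_def even_defect_commute[of x y] add.commute)

lemma even_part_double: "even_part (x + x) = even_part x + even_part x + even_part x + even_part x"
  by (simp add: even_part_def f_double f_minus_double algebra_simps)

lemma odd_part_double: "odd_part (x + x) = odd_part x + odd_part x"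
  by (simp add: odd_part_def f_double f_minus_double algebra_simps)

lemma even_term_double: "even_term (x + x) (y + y) = 16 * even_term x y"
proof -
  have "x + x + (y + y) = (x + y) + (x + y)" "x + x - (y + y) = (x - y) + (x - y)"
    by (simp_all add: algebra_simps)
  then have "even_defect (x + x) (y + y)
      = even_defect x y + even_defect x y + even_defect x y + even_defect x y"
    by (simp only: even_defect_eq even_part_double) (simp add: algebra_simps)
  then show ?thesis
    by (simp add: even_term_def even_part_double bilinear)
qed

lemma odd_term_double: "odd_term (x + x) (y + y) = 4 * odd_term x y"
proof -
  have "x + x + (y + y) = (x + y) + (x + y)" "x + x - (y + y) = (x - y) + (x - y)"
    by (simp_all add: algebra_simps)
  then have "odd_defect (x + x) (y + y) = odd_defect x y + odd_defect x y"
    by (simp only: odd_defect_eq odd_part_double) (simp add: algebra_simps)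
  then show ?thesis
    by (simp add: odd_term_def odd_part_double bilinear)
qed

text \<open>
  Adding the positivity of the defect at \<open>x\<close> and at \<open>- x\<close> makes the mixed products of even and odd
  parts cancel.
\<close>

lemma even_plus_odd_term_nonneg: "0 \<le> even_term x y + odd_term x y"
proof -
  have "0 \<le> B (f x + f x + even_part y) (defect x y)
      + B (f (- x) + f (- x) + even_part y) (defect (- x) y)"
    by (intro add_nonneg_nonneg defect_positive)
  also have "\<dots> = even_term x y + odd_term x y"
    by (simp add: even_term_def odd_term_def even_part_def odd_part_def even_defect_def
        odd_defect_def bilinear)
  finally show ?thesis .
qed

lemma even_plus_odd_term_iterate: "0 \<le> 4 ^ n * even_term x y + odd_term x y"
proof (induction n arbitrary: x y)
  case 0
  then show ?case
    using even_plus_odd_term_nonneg by simp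
next
  case (Suc n)
  have "0 \<le> 4 ^ n * (16 * even_term x y) + 4 * odd_term x y"
    using Suc[of "x + x" "y + y"] by (simp only: even_term_double odd_term_double)
  also have "\<dots> = 4 * (4 ^ Suc n * even_term x y + odd_term x y)"
    by simp
  finally show ?case
    by simp
qed

lemma even_term_nonneg: "0 \<le> even_term x y"
proof (rule ccontr)
  assume "\<not> 0 \<le> even_term x y"
  then have neg: "even_term x y < 0"
    by simp
  obtain n where "odd_term x y / (- even_term x y) < 4 ^ n"
    using real_arch_pow[of 4 "odd_term x y / (- even_term x y)"] by auto
  then have "odd_term x y < 4 ^ n * (- even_term x y)"
    using neg by (simp add: field_simps)
  with even_plus_odd_term_iterate[of n x y] show False
    by simp
qed

section \<open>Vanishing of the defect\<close>

text \<open>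
  This is \<open>norm_symmetrized_defect_le\<close> summed over the four choices of signs, which again removes the
  mixed products.
\<close>

lemma norm_defect_parts_le:
  "4 * B (even_defect x y) (even_defect x y) + B (odd_defect x y) (odd_defect x y)
      + B (odd_defect y x) (odd_defect y x)
    \<le> - 16 * B (even_part x) (even_defect x y) - 4 * odd_term x y"
proof -
  define p p' q q' where pq_def: "p = defect x y" "p' = defect (- x) y"
    "q = defect y x" "q' = defect (- y) x"
  define e d where ed_def: "e = even_part x" "d = odd_part x"
  have q': "q' = p + p' - q"
    using even_defect_commute[of x y]
    by (simp add: even_defect_def pq_def algebra_simps)
  have "B (p + q) (p + q) \<le> - 2 * B (e + e + d) (p + q)"
    using norm_symmetrized_defect_le[of x y] by (simp add: pq_def ed_def)
  moreover have "B (p + q') (p + q') \<le> - 2 * B (e + e + d) (p + q')"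
    using norm_symmetrized_defect_le[of x "- y"]
    by (simp add: pq_def ed_def defect_minus_right)
  moreover have "B (p' + q) (p' + q) \<le> - 2 * B (e + e - d) (p' + q)"
    using norm_symmetrized_defect_le[of "- x" y]
    by (simp add: pq_def ed_def defect_minus_right even_part_minus odd_part_minus)
  moreover have "B (p' + q') (p' + q') \<le> - 2 * B (e + e - d) (p' + q')"
    using norm_symmetrized_defect_le[of "- x" "- y"]
    by (simp add: pq_def ed_def defect_minus_right even_part_minus odd_part_minus)
  moreover have "even_defect x y = p + p'" "odd_defect x y = p - p'" "odd_defect y x = q - q'"
    by (simp_all add: pq_def even_defect_def odd_defect_def)
  ultimately show ?thesis
    unfolding odd_term_def q' ed_def[symmetric]
    by (simp add: bilinear sym[of p' p] sym[of q p] sym[of q p'])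
qed

lemma defect_eq_zero: "defect x y = 0"
proof -
  have "8 * B (even_defect x y) (even_defect x y) + 2 * B (odd_defect x y) (odd_defect x y)
      + 2 * B (odd_defect y x) (odd_defect y x)
    \<le> - 16 * even_term x y - 4 * odd_term x y - 4 * odd_term y x"
    using norm_defect_parts_le[of x y] norm_defect_parts_le[of y x]
    by (simp add: even_defect_commute[of y x] even_term_def add_left)
  also have "\<dots> \<le> - 8 * even_term x y"
    using even_plus_odd_term_nonneg[of x y] even_plus_odd_term_nonneg[of y x]
    by (simp add: even_term_commute[of y x])
  also have "\<dots> \<le> 0"
    using even_term_nonneg by simp
  finally have "B (even_defect x y) (even_defect x y) = 0" "B (odd_defect x y) (odd_defect x y) = 0"
    using nonneg[of "even_defect x y"] nonneg[of "odd_defect x y"] nonneg[of "odd_defect y x"]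
    by linarith+
  then have "even_defect x y = 0" "odd_defect x y = 0"
    by (simp_all add: definite)
  then have "defect x y + defect x y = 0"
    by (simp add: even_defect_def odd_defect_def)
  \<comment> \<open>The target may have 2-torsion a priori; definiteness of the form excludes it.\<close>
  then have "B (defect x y + defect x y) (defect x y + defect x y) = 0"
    by (simp only: zero_left)
  then show ?thesis
    by (intro definite) (simp add: bilinear)
qed

theorem drygas_equation: "f (x + y) + f (x - y) = f x + f x + f y + f (- y)"
  using defect_eq_zero[of x y] by (simp add: defect_def algebra_simps)

end

section \<open>Real and complex inner product spaces\<close>

lemma real_inner_drygas:
  fixes f :: "'g::ab_group_add \<Rightarrow> 'e::real_inner"
  assumes le: "\<And>x y. norm (2 *\<^sub>R f x + f y + f (- y) - f (x - y)) \<le> norm (f (x + y))"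
  shows "f (x + y) + f (x - y) = 2 *\<^sub>R f x + f y + f (- y)"
proof -
  interpret drygas_inequality "inner" f
  proof
    show "inner (f x + f x + f y + f (- y) - f (x - y)) (f x + f x + f y + f (- y) - f (x - y))
        \<le> inner (f (x + y)) (f (x + y))" for x y
      using le[of x y] by (simp add: norm_le scaleR_2)
  qed (auto simp: inner_add_left intro: inner_commute)
  show ?thesis
    using drygas_equation by (simp add: scaleR_2)
qed

lemma (in complex_inner_product_space) positive_definite_form_Re:
  "positive_definite_form (\<lambda>u v. Re (ip u v))"
proof
  show "Re (ip u v) = Re (ip v u)" for u v
    by (subst conj_sym) simp
  show "v = 0" if "Re (ip v v) = 0" for v
  proof (rule definite)
    have "Im (ip v v) = - Im (ip v v)"
      by (subst conj_sym) simp
    with that show "ip v v = 0"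
      by (simp add: complex_eq_iff)
  qed
qed (simp_all add: add_left nonneg)

lemma (in complex_inner_product_space) complex_inner_drygas:
  fixes h :: "'g::ab_group_add \<Rightarrow> 'e"
  assumes le: "\<And>x y. ip_norm ip (scale 2 (h x) + h y + h (- y) - h (x - y)) \<le> ip_norm ip (h (x + y))"
  shows "h (x + y) + h (x - y) = scale 2 (h x) + h y + h (- y)"
proof -
  have two: "scale 2 v = v + v" for v
    using scale_left_distrib[of 1 1 v] by simp
  interpret form: positive_definite_form "\<lambda>u v. Re (ip u v)"
    by (rule positive_definite_form_Re)
  interpret drygas_inequality "\<lambda>u v. Re (ip u v)" h
  proof
    show "Re (ip (h x + h x + h y + h (- y) - h (x - y)) (h x + h x + h y + h (- y) - h (x - y)))
        \<le> Re (ip (h (x + y)) (h (x + y)))" for x y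
      using le[of x y] by (simp add: ip_norm_def two)
  qed
  show ?thesis
    using drygas_equation by (simp add: two)
qed

theorem theorem2p1:
  fixes f :: "'g::ab_group_add \<Rightarrow> 'e::real_inner"
    and h :: "'g \<Rightarrow> 'c::ab_group_add"
    and scale :: "complex \<Rightarrow> 'c \<Rightarrow> 'c"
    and ip :: "'c \<Rightarrow> 'c \<Rightarrow> complex"
  shows
    "((\<forall>x y. norm (2 *\<^sub>R f x + f y + f (- y) - f (x - y)) \<le> norm (f (x + y)))
        \<longrightarrow> (\<forall>x y. f (x + y) + f (x - y) = 2 *\<^sub>R f x + f y + f (- y)))
     \<and>
     (complex_inner_product_space scale ip
        \<longrightarrow> (\<forall>x y. ip_norm ip (scale 2 (h x) + h y + h (- y) - h (x - y)) \<le> ip_norm ip (h (x + y)))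
        \<longrightarrow> (\<forall>x y. h (x + y) + h (x - y) = scale 2 (h x) + h y + h (- y)))"
  using real_inner_drygas[of f] complex_inner_product_space.complex_inner_drygas[of scale ip h]
  by blast

end
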